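(* Let $\mathbf Y\sim ESN_p(\boldsymbol\mu,\boldsymbol\Sigma,\boldsymbol\lambda,\tau)$ and $\mathbf X\sim N_{p+1}(\boldsymbol\mu^*,\boldsymbol\Omega)$. Let $\mathbf a,\mathbf b$ be (possibly infinite) lower and upper truncation limits in dimension $p$, let $\boldsymbol\kappa$ be a $p$-vector of nonnegative integers, and put $\boldsymbol\kappa^*=(\boldsymbol\kappa^\top,0)^\top$, $\mathbf a^*=(\mathbf a^\top,-\infty)^\top$, $\mathbf b^*=(\mathbf b^\top,\tilde\tau)^\top$. Then $$\mathbb E[\mathbf Y^{\boldsymbol\kappa}\mid\mathbf a\le\mathbf Y\le\mathbf b]=\mathbb E[\mathbf X^{\boldsymbol\kappa^*}\mid\mathbf a^*\le\mathbf X\le\mathbf b^*].$$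
   Context: Here $\boldsymbol\mu\in\mathbb R^p$, $\boldsymbol\Sigma$ is a $p\times p$ positive definite matrix with symmetric positive definite square root $\boldsymbol\Sigma^{1/2}$ (inverse $\boldsymbol\Sigma^{-1/2}$), $\boldsymbol\lambda\in\mathbb R^p$, $\tau\in\mathbb R$. $\phi_p(\cdot;\boldsymbol\mu,\boldsymbol\Sigma)$ is the $p$-variate normal density and $\Phi_1$ the standard univariate normal cdf. $\mathbf Y\sim ESN_p(\boldsymbol\mu,\boldsymbol\Sigma,\boldsymbol\lambda,\tau)$ (extended skew-normal) means that $\mathbf Y$ has density $$\xi^{-1}\phi_p(\mathbf y;\boldsymbol\mu,\boldsymbol\Sigma)\,\Phi_1\big(\tau+\boldsymbol\lambda^\top\boldsymbol\Sigma^{-1/2}(\mathbf y-\boldsymbol\mu)\big),\qquad \xi=\Phi_1(\tilde\tau),\quad \tilde\tau=\tau/(1+\boldsymbol\lambda^\top\boldsymbol\lambda)^{1/2}.$$ Set $\boldsymbol\Delta=\boldsymbol\Sigma^{1/2}\boldsymbol\lambda/(1+\boldsymbol\lambda^\top\boldsymbol\lambda)^{1/2}$, $\boldsymbol\mu^*=(\boldsymbol\mu^\top,0)^\top$ and $\boldsymbol\Omega=\begin{pmatrix}\boldsymbol\Sigma&-\boldsymbol\Delta\\-\boldsymbol\Delta^\top&1\end{pmatrix}$. Inequalities between vectors are componentwise, $\mathbf x^{\boldsymbol\kappa}=\prod_i x_i^{k_i}$, and the truncation box $\{\mathbf a\le\mathbf y\le\mathbf b\}$ is such that the conditioning event has positive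 probability. *)

theory Defs
  imports "HOL-Probability.Probability"
begin

definition pos_def :: "real ^ 'n ^ 'n \<Rightarrow> bool" where
  "pos_def A \<longleftrightarrow> transpose A = A \<and> (\<forall>x. x \<noteq> 0 \<longrightarrow> 0 < x \<bullet> (A *v x))"

definition mat_sqrt :: "real ^ 'n ^ 'n \<Rightarrow> real ^ 'n ^ 'n" where
  "mat_sqrt A = (THE S. pos_def S \<and> S ** S = A)"

definition mvn_density :: "real ^ 'n \<Rightarrow> real ^ 'n ^ 'n \<Rightarrow> real ^ 'n \<Rightarrow> real" where
  "mvn_density \<mu> \<Sigma> x =
     exp (- ((x - \<mu>) \<bullet> (matrix_inv \<Sigma> *v (x - \<mu>))) / 2) / sqrt ((2 * pi) ^ CARD('n) * det \<Sigma>)"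

definition std_normal_cdf :: "real \<Rightarrow> real" where
  "std_normal_cdf = cdf std_normal_distribution"

definition esn_tau :: "real ^ 'n \<Rightarrow> real \<Rightarrow> real" where
  "esn_tau l \<tau> = \<tau> / sqrt (1 + l \<bullet> l)"

definition esn_density ::
  "real ^ 'n \<Rightarrow> real ^ 'n ^ 'n \<Rightarrow> real ^ 'n \<Rightarrow> real \<Rightarrow> real ^ 'n \<Rightarrow> real" where
  "esn_density \<mu> \<Sigma> l \<tau> y =
     inverse (std_normal_cdf (esn_tau l \<tau>)) * mvn_density \<mu> \<Sigma> y *
     std_normal_cdf (\<tau> + l \<bullet> (matrix_inv (mat_sqrt \<Sigma>) *v (y - \<mu>)))"

definition esn_Delta :: "real ^ 'n ^ 'n \<Rightarrow> real ^ 'n \<Rightarrow> real ^ 'n" where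
  "esn_Delta \<Sigma> l = (1 / sqrt (1 + l \<bullet> l)) *\<^sub>R (mat_sqrt \<Sigma> *v l)"

text \<open>
  Vectors of dimension \<open>p + 1\<close> are indexed by \<open>'n option\<close>, where \<open>p = CARD('n)\<close>:
  the index \<open>Some i\<close> is the \<open>i\<close>-th of the first \<open>p\<close> coordinates and \<open>None\<close> is the last one.
\<close>

definition vec_snoc :: "'a ^ 'n \<Rightarrow> 'a \<Rightarrow> 'a ^ ('n option)" where
  "vec_snoc v c = (\<chi> i. case i of Some j \<Rightarrow> v $ j | None \<Rightarrow> c)"

definition esn_Omega :: "real ^ 'n ^ 'n \<Rightarrow> real ^ 'n \<Rightarrow> real ^ ('n option) ^ ('n option)" where
  "esn_Omega \<Sigma> l =
     vec_snoc (\<chi> i. vec_snoc (\<Sigma> $ i) (- esn_Delta \<Sigma> l $ i)) (vec_snoc (- esn_Delta \<Sigma> l) 1)"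

definition has_mvn :: "'a measure \<Rightarrow> ('a \<Rightarrow> real ^ 'n) \<Rightarrow> real ^ 'n \<Rightarrow> real ^ 'n ^ 'n \<Rightarrow> bool" where
  "has_mvn M X \<mu> \<Sigma> \<longleftrightarrow> distributed M lborel X (\<lambda>x. ennreal (mvn_density \<mu> \<Sigma> x))"

definition has_esn ::
  "'a measure \<Rightarrow> ('a \<Rightarrow> real ^ 'n) \<Rightarrow> real ^ 'n \<Rightarrow> real ^ 'n ^ 'n \<Rightarrow> real ^ 'n \<Rightarrow> real \<Rightarrow> bool" where
  "has_esn M Y \<mu> \<Sigma> l \<tau> \<longleftrightarrow> distributed M lborel Y (\<lambda>y. ennreal (esn_density \<mu> \<Sigma> l \<tau> y))"

definition trunc_event ::
  "'a measure \<Rightarrow> ('a \<Rightarrow> real ^ 'n) \<Rightarrow> ereal ^ 'n \<Rightarrow> ereal ^ 'n \<Rightarrow> 'a set" where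
  "trunc_event M X a b = {\<omega> \<in> space M. \<forall>i. a $ i \<le> ereal (X \<omega> $ i) \<and> ereal (X \<omega> $ i) \<le> b $ i}"

definition vec_power :: "real ^ 'n \<Rightarrow> nat ^ 'n \<Rightarrow> real" where
  "vec_power x k = (\<Prod>i\<in>UNIV. x $ i ^ k $ i)"

text \<open>Conditional expectation given an event \<open>A\<close> of positive probability.\<close>

definition event_expectation :: "'a measure \<Rightarrow> ('a \<Rightarrow> real) \<Rightarrow> 'a set \<Rightarrow> real" where
  "event_expectation M f A = (LINT \<omega>:A|M. f \<omega>) / measure M A"

end

theory Submission
  imports Defs
begin

text \<open>
  The pair of vectors is linked by selection: if \<open>X = (X\<^sub>1, X\<^sub>0)\<close> is normal with covariance \<open>\<Omega>\<close>, then
  \<open>X\<^sub>1\<close> conditioned on \<open>X\<^sub>0 \<le> \<tau> / \<surd>(1 + \<lambda> \<bullet> \<lambda>)\<close> is extended skew-normal. Given that, restricting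
  \<open>X\<^sub>1\<close> further to the box \<open>[a, b]\<close> is the same as restricting \<open>Y\<close>, and the exponent \<open>0\<close> makes the
  monomial independent of \<open>X\<^sub>0\<close>.

  The link is a computation with densities. The inverse of \<open>\<Omega>\<close> gives the quadratic form
  \<open>y \<bullet> \<Sigma>\<^sup>-\<^sup>1 y + (\<surd>(1 + \<lambda> \<bullet> \<lambda>) t + \<lambda> \<bullet> \<Sigma>\<^sup>-\<^sup>1\<^sup>/\<^sup>2 y)\<^sup>2\<close> (\<open>esn_Omega_quadratic_form\<close>), so integrating the
  joint density over the admissible \<open>t\<close> produces \<open>exp (- y \<bullet> \<Sigma>\<^sup>-\<^sup>1 y / 2)\<close> times the normal cdf at
  \<open>\<tau> + \<lambda> \<bullet> \<Sigma>\<^sup>-\<^sup>1\<^sup>/\<^sup>2 y\<close>, up to a constant factor (\<open>nn_integral_truncated_last_coordinate\<close>; here \<open>y\<close> is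
  centred at \<open>\<mu>\<close>). A conditional expectation is a quotient of two integrals in which such a factor
  cancels (\<open>event_expectation_proportional_density\<close>). All that is asked of the factors is that they be
  positive, and this follows from the total mass being one (\<open>density_constant_pos\<close>); in particular
  \<open>det \<Omega>\<close> is never computed.

  The definition of \<open>mat_sqrt\<close> by description has content only once a positive definite square root is
  known to exist and to be unique. Existence comes from Banach's fixed-point theorem
  (\<open>blinfun_quadratic_fixed_point\<close>), uniqueness from a trace identity (\<open>pos_def_sqrt_unique\<close>).
\<close>

section \<open>The square root of a positive definite matrix\<close>

lemma symmetric_inner_matrix:
  fixes A :: "real ^ 'n ^ 'n"
  assumes "transpose A = A"
  shows "x \<bullet> (A *v y) = (A *v x) \<bullet> y"
  by (metis assms dot_lmul_matrix transpose_matrix_vector)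

text \<open>
  The quadratic form is homogeneous of degree two, so its minimum on the compact unit sphere
  serves as a coercivity constant.
\<close>

lemma pos_def_coercive:
  fixes A :: "real ^ 'n ^ 'n"
  assumes "pos_def A"
  obtains m where "0 < m" "\<And>x. m * (norm x)\<^sup>2 \<le> x \<bullet> (A *v x)"
proof -
  let ?U = "sphere 0 1 :: (real ^ 'n) set"
  have cont: "continuous_on ?U (\<lambda>x. x \<bullet> (A *v x))"
    by (intro continuous_intros matrix_vector_mult_linear_continuous_on)
  have "axis undefined 1 \<in> ?U" by simp
  then obtain u where u: "u \<in> ?U" and min: "\<And>x. x \<in> ?U \<Longrightarrow> u \<bullet> (A *v u) \<le> x \<bullet> (A *v x)"
    using continuous_attains_inf[OF compact_sphere _ cont] by auto
  show thesis
  proof (rule that)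
    have "u \<noteq> 0" using u by auto
    then show "0 < u \<bullet> (A *v u)"
      using assms by (simp add: pos_def_def)
    show "u \<bullet> (A *v u) * (norm x)\<^sup>2 \<le> x \<bullet> (A *v x)" for x
    proof (cases "x = 0")
      case False
      let ?e = "(1 / norm x) *\<^sub>R x"
      have "?e \<in> ?U" using False by simp
      then have "u \<bullet> (A *v u) \<le> ?e \<bullet> (A *v ?e)" by (rule min)
      also have "\<dots> = x \<bullet> (A *v x) / (norm x)\<^sup>2"
        by (simp add: matrix_vector_mult_scaleR power2_eq_square)
      finally show ?thesis
        using False by (simp add: field_simps)
    qed simp
  qed
qed

text \<open>
  This puts a multiple of \<open>A\<close> within operator distance \<open>q < 1\<close> of the identity, which is what the
  fixed-point construction of the square root needs. With \<open>m\<close> the coercivity constant and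
  \<open>K \<ge> m\<close> a bound on the operator norm,
  \<open>\<bar>x - A x / c\<bar>\<^sup>2 \<le> (1 - 2 m / c + K\<^sup>2 / c\<^sup>2) \<bar>x\<bar>\<^sup>2\<close>,
  and \<open>c = K\<^sup>2 / m\<close> minimises the factor, with value \<open>1 - m\<^sup>2 / K\<^sup>2\<close>.
\<close>

lemma pos_def_scaled_near_identity:
  fixes A :: "real ^ 'n ^ 'n"
  assumes "pos_def A"
  obtains c q where "0 < c" "0 \<le> q" "q < 1" "\<And>x. norm (x - (1 / c) *\<^sub>R (A *v x)) \<le> q * norm x"
proof -
  obtain m where m: "0 < m" "\<And>x. m * (norm x)\<^sup>2 \<le> x \<bullet> (A *v x)"
    using pos_def_coercive[OF assms] by blast
  obtain K0 where K0: "\<And>x. norm (A *v x) \<le> norm x * K0"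
    using bounded_linear.bounded[OF matrix_vector_mul_bounded_linear[of A]] by blast
  \<comment> \<open>Enlarging \<open>K0\<close> ensures \<open>m \<le> K\<close>, so that the radicand in \<open>q\<close> is not negative.\<close>
  define K where "K = max K0 m"
  have K: "norm (A *v x) \<le> K * norm x" for x
    by (rule order_trans[OF K0]) (simp add: K_def mult.commute[of _ "norm x"] mult_left_mono)
  have "m \<le> K" by (simp add: K_def)
  define c where "c = K\<^sup>2 / m"
  define q where "q = sqrt (1 - m\<^sup>2 / K\<^sup>2)"
  have "0 < K" using m(1) \<open>m \<le> K\<close> by simp
  have r: "m\<^sup>2 / K\<^sup>2 \<le> 1" "0 < m\<^sup>2 / K\<^sup>2"
    using \<open>m \<le> K\<close> m(1) \<open>0 < K\<close> by (simp_all add: power_mono)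
  have "0 < c" using m(1) \<open>0 < K\<close> by (simp add: c_def)
  show thesis
  proof (rule that)
    show "0 < c" by fact
    show "0 \<le> q" "q < 1" using r by (simp_all add: q_def)
    fix x
    have "(norm (x - (1 / c) *\<^sub>R (A *v x)))\<^sup>2
        = (norm x)\<^sup>2 - 2 / c * (x \<bullet> (A *v x)) + (norm (A *v x))\<^sup>2 / c\<^sup>2"
      using dot_norm_neg[of x "(1 / c) *\<^sub>R (A *v x)"] \<open>0 < c\<close>
      by (simp add: field_simps power2_eq_square)
    also have "\<dots> \<le> (norm x)\<^sup>2 - 2 / c * (m * (norm x)\<^sup>2) + (K * norm x)\<^sup>2 / c\<^sup>2"
      using m(2)[of x] power_mono[OF K[of x] norm_ge_zero, of 2] \<open>0 < c\<close>
      by (intro add_mono diff_mono mult_left_mono divide_right_mono) auto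
    also have "\<dots> = (1 - m\<^sup>2 / K\<^sup>2) * (norm x)\<^sup>2"
      using m(1) \<open>0 < K\<close> by (simp add: c_def field_simps power2_eq_square)
    also have "\<dots> = (q * norm x)\<^sup>2"
      using r by (simp add: q_def power_mult_distrib)
    finally show "norm (x - (1 / c) *\<^sub>R (A *v x)) \<le> q * norm x"
      by (rule power2_le_imp_le) (use r in \<open>simp add: q_def\<close>)
  qed
qed

text \<open>
  A solution \<open>Z\<close> satisfies \<open>(1 - Z)\<^sup>2 = 1 - B\<close>, so \<open>1 - Z\<close> is a square root of \<open>1 - B\<close>. The map
  \<open>Z \<mapsto> (B + Z\<^sup>2) / 2\<close> sends the symmetric operators of norm at most \<open>q\<close> to themselves because
  \<open>(q + q\<^sup>2) / 2 \<le> q\<close>, and it contracts distances by \<open>q\<close> there because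
  \<open>Z\<^sup>2 - W\<^sup>2 = Z (Z - W) + (Z - W) W\<close>. This set of operators is closed, so Banach's theorem applies.
\<close>

lemma blinfun_quadratic_fixed_point:
  fixes B :: "'a::euclidean_space \<Rightarrow>\<^sub>L 'a"
  assumes q: "norm B \<le> q" "q < 1"
    and sym: "\<And>x y. x \<bullet> B y = B x \<bullet> y"
  obtains Z :: "'a \<Rightarrow>\<^sub>L 'a" where "norm Z \<le> q" "\<And>x y. x \<bullet> Z y = Z x \<bullet> y" "B + (Z o\<^sub>L Z) = 2 *\<^sub>R Z"
proof -
  have "0 \<le> q" using q(1) norm_ge_zero order_trans by blast
  define C :: "('a \<Rightarrow>\<^sub>L 'a) set" where
    "C = cball 0 q \<inter> {Z. \<forall>x y. x \<bullet> blinfun_apply Z y = blinfun_apply Z x \<bullet> y}"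
  define F where "F Z = (1/2) *\<^sub>R (B + (Z o\<^sub>L Z))" for Z :: "'a \<Rightarrow>\<^sub>L 'a"
  have "\<exists>!Z\<in>C. F Z = Z"
  proof (rule Banach_fix)
    show "uniform_space_class.complete C"
      unfolding C_def complete_eq_closed
      by (intro closed_Int closed_cball closed_Collect_all closed_Collect_eq continuous_intros)
    show "C \<noteq> {}"
    proof -
      have "0 \<in> C" using \<open>0 \<le> q\<close> by (simp add: C_def)
      then show ?thesis by blast
    qed
    show "F ` C \<subseteq> C"
    proof safe
      fix Z assume Z: "Z \<in> C"
      then have nZ: "norm Z \<le> q" by (simp add: C_def)
      have "norm (F Z) \<le> (norm B + norm (Z o\<^sub>L Z)) / 2"
        by (simp add: F_def norm_triangle_ineq)
      also have "\<dots> \<le> (q + q * 1) / 2"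
      proof -
        have "norm (Z o\<^sub>L Z) \<le> norm Z * norm Z" by (rule norm_blinfun_compose)
        also have "\<dots> \<le> q * 1" using nZ q(2) \<open>0 \<le> q\<close> by (intro mult_mono) auto
        finally show ?thesis using q(1) by simp
      qed
      finally have "norm (F Z) \<le> q" by simp
      moreover have "x \<bullet> F Z y = F Z x \<bullet> y" for x y
        using Z sym by (simp add: F_def C_def blinfun.bilinear_simps inner_add)
      ultimately show "F Z \<in> C" by (simp add: C_def)
    qed
    show "dist (F Z) (F W) \<le> q * dist Z W" if "Z \<in> C" "W \<in> C" for Z W
    proof -
      have n: "norm Z \<le> q" "norm W \<le> q" using that by (simp_all add: C_def)
      have "F Z - F W = (1/2) *\<^sub>R ((Z o\<^sub>L (Z - W)) + ((Z - W) o\<^sub>L W))"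
        by (rule blinfun_eqI) (simp add: F_def blinfun.bilinear_simps algebra_simps)
      then have "norm (F Z - F W) \<le> (norm (Z o\<^sub>L (Z - W)) + norm ((Z - W) o\<^sub>L W)) / 2"
        by (simp add: norm_triangle_ineq)
      also have "\<dots> \<le> (q * norm (Z - W) + norm (Z - W) * q) / 2"
        by (intro divide_right_mono add_mono order_trans[OF norm_blinfun_compose] mult_mono n)
          (use \<open>0 \<le> q\<close> in auto)
      finally show ?thesis by (simp add: dist_norm mult.commute)
    qed
  qed fact+
  then obtain Z where "Z \<in> C" and fixed: "F Z = Z" by blast
  then show thesis
  proof (intro that)
    have "2 *\<^sub>R F Z = B + (Z o\<^sub>L Z)" by (simp add: F_def)
    then show "B + (Z o\<^sub>L Z) = 2 *\<^sub>R Z" by (simp add: fixed)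
  qed (simp_all add: C_def)
qed

text \<open>
  Write \<open>A = c (1 - B)\<close> with \<open>B\<close> symmetric of norm \<open>q < 1\<close>, and let \<open>Z\<close> be the fixed point above.
  Then \<open>S = \<surd>c (1 - Z)\<close> squares to \<open>A\<close>, and it is positive definite because \<open>\<bar>Z\<bar> \<le> q < 1\<close>.
\<close>

lemma pos_def_sqrt_exists:
  fixes A :: "real ^ 'n ^ 'n"
  assumes "pos_def A"
  obtains S where "pos_def S" "S ** S = A"
proof -
  obtain c q where c: "0 < c" and q: "0 \<le> q" "q < 1"
    and bound: "\<And>x. norm (x - (1 / c) *\<^sub>R (A *v x)) \<le> q * norm x"
    using pos_def_scaled_near_identity[OF assms] by blast
  have symA: "x \<bullet> (A *v y) = (A *v x) \<bullet> y" for x y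
    using assms by (intro symmetric_inner_matrix) (simp add: pos_def_def)
  have bl: "bounded_linear (\<lambda>x. x - (1 / c) *\<^sub>R (A *v x))"
    by (intro bounded_linear_sub bounded_linear_ident
        bounded_linear_compose[OF bounded_linear_scaleR_right matrix_vector_mul_bounded_linear])
  define B where "B = Blinfun (\<lambda>x. x - (1 / c) *\<^sub>R (A *v x))"
  have B: "blinfun_apply B x = x - (1 / c) *\<^sub>R (A *v x)" for x
    by (simp add: B_def bounded_linear_Blinfun_apply[OF bl])
  have "norm B \<le> q"
    by (rule norm_blinfun_bound) (simp_all add: q B bound)
  moreover have "x \<bullet> B y = B x \<bullet> y" for x y
    by (simp add: B inner_diff symA)
  ultimately obtain Z where Z: "norm Z \<le> q" "\<And>x y. x \<bullet> blinfun_apply Z y = blinfun_apply Z x \<bullet> y"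
      and eq: "B + (Z o\<^sub>L Z) = 2 *\<^sub>R Z"
    using blinfun_quadratic_fixed_point[of B q] q(2) by blast
  define f where "f x = sqrt c *\<^sub>R (x - blinfun_apply Z x)" for x
  have lin: "linear f"
    unfolding f_def
    by (intro bounded_linear.linear bounded_linear_compose[OF bounded_linear_scaleR_right]
        bounded_linear_sub bounded_linear_ident blinfun.bounded_linear_right)
  define S where "S = matrix f"
  have S: "S *v x = f x" for x
    by (simp add: S_def matrix_works[OF lin[unfolded linear_matrix_vector_mul_eq[symmetric]]])
  have symS: "x \<bullet> (S *v y) = (S *v x) \<bullet> y" for x y
    by (simp add: S f_def inner_diff Z(2))
  show thesis
  proof (rule that)
    have "transpose S *v x = S *v x" for x
      by (rule vector_eq_rdot[THEN iffD1])
        (metis dot_lmul_matrix inner_commute symS transpose_matrix_vector)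
    then have "transpose S = S" by (simp add: matrix_eq)
    moreover have "0 < x \<bullet> (S *v x)" if "x \<noteq> 0" for x
    proof -
      have "x \<bullet> Z x \<le> norm x * norm (Z x)" by (rule norm_cauchy_schwarz)
      also have "\<dots> \<le> norm x * (q * norm x)"
        by (intro mult_left_mono order_trans[OF norm_blinfun] mult_right_mono Z(1)) auto
      also have "\<dots> < x \<bullet> x"
        using that q(2) by (simp add: dot_square_norm power2_eq_square)
      finally show ?thesis using c by (simp add: S f_def inner_diff)
    qed
    ultimately show "pos_def S" by (simp add: pos_def_def)
    have "(S ** S) *v x = A *v x" for x
    proof -
      have "Z (Z x) = 2 *\<^sub>R Z x - B x"
        using arg_cong[OF eq, of "\<lambda>T. blinfun_apply T x"]
        by (simp add: blinfun.bilinear_simps algebra_simps)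
      moreover have "(S ** S) *v x = c *\<^sub>R (x - 2 *\<^sub>R Z x + Z (Z x))"
        using c by (simp add: S f_def blinfun.bilinear_simps algebra_simps scaleR_2
            flip: matrix_vector_mul_assoc)
      ultimately show ?thesis using c by (simp add: B)
    qed
    then show "S ** S = A" by (simp add: matrix_eq)
  qed
qed

text \<open>
  For positive definite \<open>P\<close> and symmetric \<open>D\<close> this exhibits the trace of \<open>D P D\<close> as a sum of nonnegative terms that
  vanishes only for \<open>D = 0\<close>; uniqueness of the square root rests on it.
\<close>

lemma trace_congruence:
  fixes D P :: "real ^ 'n ^ 'n"
  assumes "transpose D = D"
  shows "trace (D ** (P ** D)) = (\<Sum>i\<in>UNIV. (D *v axis i 1) \<bullet> (P *v (D *v axis i 1)))"
proof -
  have "(D ** (P ** D)) $ i $ i = axis i 1 \<bullet> (D *v (P *v (D *v axis i 1)))" for i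
    by (simp add: matrix_vector_mul_assoc inner_axis' matrix_vector_mul_component inner_axis
        matrix_mul_assoc)
  then show ?thesis
    by (simp add: trace_def symmetric_inner_matrix[OF assms])
qed

text \<open>
  The difference \<open>D = S - T\<close> of two roots satisfies \<open>S D + D T = S\<^sup>2 - T\<^sup>2 = 0\<close>. Multiplying by \<open>D\<close>
  and taking traces gives \<open>tr (D S D) + tr (D T D) = 0\<close>, a sum of nonnegative terms, whence
  \<open>D e\<^sub>i = 0\<close> for each unit vector \<open>e\<^sub>i\<close>.
\<close>

lemma pos_def_sqrt_unique:
  fixes S T :: "real ^ 'n ^ 'n"
  assumes "pos_def S" "pos_def T" "S ** S = T ** T"
  shows "S = T"
proof -
  define D where "D = S - T"
  have "transpose D = D"
    using assms by (simp add: D_def pos_def_def transpose_def vec_eq_iff)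
  have zero: "S ** D + D ** T = 0"
    using assms(3)
    by (simp add: D_def matrix_eq algebra_simps matrix_vector_mult_add_rdistrib
        flip: matrix_vector_mul_assoc)
  have "trace (D ** (S ** D)) + trace (D ** (T ** D)) = trace (D ** (S ** D) + D ** (D ** T))"
    by (metis matrix_mul_assoc trace_add trace_mul_sym)
  also have "\<dots> = 0"
    by (simp add: zero trace_def flip: matrix_add_ldistrib)
  finally have sum0: "(\<Sum>i\<in>UNIV. (D *v axis i 1) \<bullet> (S *v (D *v axis i 1))
      + (D *v axis i 1) \<bullet> (T *v (D *v axis i 1))) = 0"
    by (simp add: trace_congruence[OF \<open>transpose D = D\<close>] sum.distrib)
  have pos: "0 < x \<bullet> (S *v x) + x \<bullet> (T *v x)" if "x \<noteq> 0" for x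
    using assms that by (simp add: pos_def_def add_pos_pos)
  have nonneg: "0 \<le> x \<bullet> (S *v x) + x \<bullet> (T *v x)" for x
    using pos[of x] by (cases "x = 0") auto
  have "D *v axis i 1 = 0" for i
  proof (rule ccontr)
    assume "D *v axis i 1 \<noteq> 0"
    then have "0 < (\<Sum>i\<in>UNIV. (D *v axis i 1) \<bullet> (S *v (D *v axis i 1))
      + (D *v axis i 1) \<bullet> (T *v (D *v axis i 1)))"
      by (intro sum_pos2[of _ i] pos nonneg) auto
    then show False using sum0 by simp
  qed
  then have "D = 0"
    by (simp add: vec_eq_iff matrix_vector_mul_component inner_axis)
  then show ?thesis by (simp add: D_def)
qed

lemma mat_sqrt:
  assumes "pos_def A"
  shows "pos_def (mat_sqrt A)" "mat_sqrt A ** mat_sqrt A = A"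
proof -
  have "\<exists>!S. pos_def S \<and> S ** S = A"
    using pos_def_sqrt_exists[OF assms] pos_def_sqrt_unique by metis
  from theI'[OF this] show "pos_def (mat_sqrt A)" "mat_sqrt A ** mat_sqrt A = A"
    by (simp_all add: mat_sqrt_def)
qed

section \<open>Matrix inverses\<close>

lemma pos_def_invertible:
  assumes "pos_def A"
  shows "invertible A"
proof -
  have "x = 0" if "A *v x = 0" for x
    using assms that unfolding pos_def_def by (metis inner_zero_right less_irrefl)
  then show ?thesis
    by (simp add: invertible_left_inverse matrix_left_invertible_ker)
qed

lemma
  fixes A :: "real ^ 'n ^ 'n"
  assumes "invertible A"
  shows matrix_inv_left: "matrix_inv A *v (A *v x) = x"
    and matrix_inv_right: "A *v (matrix_inv A *v x) = x"
proof -
  have "A ** matrix_inv A = mat 1 \<and> matrix_inv A ** A = mat 1"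
    unfolding matrix_inv_def by (rule someI_ex) (use assms in \<open>simp add: invertible_def\<close>)
  then show "matrix_inv A *v (A *v x) = x" "A *v (matrix_inv A *v x) = x"
    by (simp_all add: matrix_vector_mul_assoc)
qed

text \<open>
  Pointwise solutions of \<open>A v = x\<close> make \<open>A\<close> surjective, hence invertible, so solving a linear system
  is enough to compute with the inverse.
\<close>

lemma matrix_inv_eqI:
  fixes A :: "real ^ 'n ^ 'n"
  assumes "\<And>x. A *v g x = x"
  shows "matrix_inv A *v x = g x"
proof -
  have "surj ((*v) A)" using assms by (metis surjI)
  then have "invertible A"
    by (simp add: invertible_right_inverse matrix_right_invertible_surjective)
  then show ?thesis using matrix_inv_left[of A "g x"] assms by simp
qed

section \<open>Appending a coordinate\<close>

definition vec_init :: "'a ^ ('n option) \<Rightarrow> 'a ^ 'n" where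
  "vec_init x = (\<chi> i. x $ Some i)"

lemma vec_init_nth [simp]: "vec_init x $ i = x $ Some i"
  by (simp add: vec_init_def)

lemma vec_snoc_nth [simp]:
  "vec_snoc v c $ Some j = v $ j" "vec_snoc v c $ None = c"
  by (simp_all add: vec_snoc_def)

lemma vec_init_snoc [simp]: "vec_init (vec_snoc v c) = v"
  by (simp add: vec_eq_iff)

lemma all_option: "(\<forall>i. P i) \<longleftrightarrow> P None \<and> (\<forall>j. P (Some j))"
  by (metis option.exhaust)

lemma sum_option: "(\<Sum>i\<in>UNIV. f i) = f None + (\<Sum>j\<in>UNIV. f (Some j))"
  for f :: "'n::finite option \<Rightarrow> 'b::comm_monoid_add"
  by (simp add: UNIV_option_conv sum.reindex)

lemma prod_option: "(\<Prod>i\<in>UNIV. f i) = f None * (\<Prod>j\<in>UNIV. f (Some j))"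
  for f :: "'n::finite option \<Rightarrow> 'b::comm_monoid_mult"
  by (simp add: UNIV_option_conv prod.reindex)

lemma vec_snoc_inner: "vec_snoc u s \<bullet> vec_snoc v t = u \<bullet> v + s * t"
  by (simp add: inner_vec_def sum_option)

lemma vec_snoc_diff: "vec_snoc u s - vec_snoc v t = vec_snoc (u - v) (s - t)"
  by (simp add: vec_eq_iff all_option)

section \<open>The quadratic form of the extended covariance matrix\<close>

lemma esn_Omega_mult:
  "esn_Omega \<Sigma> l *v vec_snoc u s =
    vec_snoc (\<Sigma> *v u - s *\<^sub>R esn_Delta \<Sigma> l) (s - esn_Delta \<Sigma> l \<bullet> u)"
  by (simp add: vec_eq_iff all_option esn_Omega_def matrix_vector_mult_def sum_option
      inner_vec_def sum_negf)

text \<open>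
  With \<open>S\<close> the square root, \<open>\<Sigma>\<^sup>-\<^sup>1 = S\<^sup>-\<^sup>1 S\<^sup>-\<^sup>1\<close>; one factor cancels the \<open>S\<close> in \<open>\<Delta> = S \<lambda> / \<surd>(1 + \<lambda> \<bullet> \<lambda>)\<close>.
\<close>

lemma esn_Delta_inverse_inner:
  assumes "pos_def \<Sigma>"
  shows "esn_Delta \<Sigma> l \<bullet> (matrix_inv \<Sigma> *v y) = (l \<bullet> (matrix_inv (mat_sqrt \<Sigma>) *v y)) / sqrt (1 + l \<bullet> l)"
proof -
  let ?S = "mat_sqrt \<Sigma>"
  have S: "pos_def ?S" "?S ** ?S = \<Sigma>" using mat_sqrt[OF assms] by simp_all
  have \<Sigma>: "\<Sigma> *v v = ?S *v (?S *v v)" for v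
    by (simp add: matrix_vector_mul_assoc S(2))
  have "matrix_inv ?S *v y = matrix_inv ?S *v (\<Sigma> *v (matrix_inv \<Sigma> *v y))"
    by (simp add: matrix_inv_right pos_def_invertible assms)
  also have "\<dots> = ?S *v (matrix_inv \<Sigma> *v y)"
    by (simp only: \<Sigma>[of "matrix_inv \<Sigma> *v y"] matrix_inv_left[OF pos_def_invertible[OF S(1)]])
  finally show ?thesis
    using S(1) by (simp add: esn_Delta_def pos_def_def symmetric_inner_matrix)
qed

lemma esn_Delta_inverse_Delta:
  assumes "pos_def \<Sigma>"
  shows "esn_Delta \<Sigma> l \<bullet> (matrix_inv \<Sigma> *v esn_Delta \<Sigma> l) = (l \<bullet> l) / (1 + l \<bullet> l)"
proof -
  have "0 < 1 + l \<bullet> l" by (simp add: add_pos_nonneg)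
  then show ?thesis
    using mat_sqrt[OF assms]
    by (subst esn_Delta_inverse_inner[OF assms])
      (simp add: esn_Delta_def matrix_inv_left pos_def_invertible matrix_vector_mult_scaleR)
qed

text \<open>
  Completing the square. Solving \<open>\<Omega> (u, s) = (y, t)\<close> by elimination gives
  \<open>s = (1 + \<lambda> \<bullet> \<lambda>) (t + \<Delta> \<bullet> \<Sigma>\<^sup>-\<^sup>1 y)\<close> and \<open>u = \<Sigma>\<^sup>-\<^sup>1 (y + s \<Delta>)\<close>, where the factor in \<open>s\<close> is the
  reciprocal of the Schur complement \<open>1 - \<Delta> \<bullet> \<Sigma>\<^sup>-\<^sup>1 \<Delta>\<close>. In probabilistic terms: given the first
  coordinates \<open>y\<close>, the last one has mean \<open>-\<Delta> \<bullet> \<Sigma>\<^sup>-\<^sup>1 y\<close> and variance \<open>1 / (1 + \<lambda> \<bullet> \<lambda>)\<close>.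
\<close>

lemma esn_Omega_quadratic_form:
  assumes "pos_def \<Sigma>"
  shows "vec_snoc y t \<bullet> (matrix_inv (esn_Omega \<Sigma> l) *v vec_snoc y t) =
    y \<bullet> (matrix_inv \<Sigma> *v y) + (sqrt (1 + l \<bullet> l) * t + l \<bullet> (matrix_inv (mat_sqrt \<Sigma>) *v y))\<^sup>2"
proof -
  define D where "D = esn_Delta \<Sigma> l"
  define r where "r = 1 + l \<bullet> l"
  have "0 < r" by (simp add: r_def add_pos_nonneg)
  \<comment> \<open>\<open>w x\<close> is the last coordinate of the solution of \<open>\<Omega> v = x\<close>, and \<open>g x\<close> the whole solution.\<close>
  define w where "w x = r * (x $ None + D \<bullet> (matrix_inv \<Sigma> *v vec_init x))" for x :: "real ^ 'a option"
  define g where "g x = vec_snoc (matrix_inv \<Sigma> *v (vec_init x + w x *\<^sub>R D)) (w x)" for x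
  have inv: "\<Sigma> *v (matrix_inv \<Sigma> *v v) = v" for v
    by (simp add: matrix_inv_right pos_def_invertible assms)
  have DD: "D \<bullet> (matrix_inv \<Sigma> *v D) = (r - 1) / r"
    by (simp add: D_def r_def esn_Delta_inverse_Delta[OF assms])
  have sym: "y \<bullet> (matrix_inv \<Sigma> *v D) = D \<bullet> (matrix_inv \<Sigma> *v y)"
    using assms by (metis inner_commute inv pos_def_def symmetric_inner_matrix)
  have "esn_Omega \<Sigma> l *v g x = x" for x
  proof -
    have "w x - D \<bullet> (matrix_inv \<Sigma> *v (vec_init x + w x *\<^sub>R D)) = x $ None"
      using \<open>0 < r\<close>
      by (simp add: matrix_vector_right_distrib matrix_vector_mult_scaleR inner_add DD w_def field_simps)
    then show ?thesis
      by (simp add: g_def esn_Omega_mult inv flip: D_def) (simp add: vec_eq_iff all_option)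
  qed
  then have "matrix_inv (esn_Omega \<Sigma> l) *v vec_snoc y t = g (vec_snoc y t)"
    by (rule matrix_inv_eqI)
  then have "vec_snoc y t \<bullet> (matrix_inv (esn_Omega \<Sigma> l) *v vec_snoc y t) =
      y \<bullet> (matrix_inv \<Sigma> *v y) + r * (t + D \<bullet> (matrix_inv \<Sigma> *v y))\<^sup>2"
    by (simp add: g_def vec_snoc_inner matrix_vector_right_distrib matrix_vector_mult_scaleR
        inner_add sym w_def power2_eq_square algebra_simps)
  also have "r * (t + D \<bullet> (matrix_inv \<Sigma> *v y))\<^sup>2
      = (sqrt r * (t + D \<bullet> (matrix_inv \<Sigma> *v y)))\<^sup>2"
    using \<open>0 < r\<close> by (simp add: power_mult_distrib)
  also have "sqrt r * (t + D \<bullet> (matrix_inv \<Sigma> *v y))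
      = sqrt r * t + l \<bullet> (matrix_inv (mat_sqrt \<Sigma>) *v y)"
    using \<open>0 < r\<close> by (simp add: D_def esn_Delta_inverse_inner[OF assms] flip: r_def)
      (simp add: field_simps)
  finally show ?thesis by (simp add: r_def)
qed

definition mvn_const :: "real ^ 'n ^ 'n \<Rightarrow> real" where
  "mvn_const \<Sigma> = 1 / sqrt ((2 * pi) ^ CARD('n) * det \<Sigma>)"

lemma mvn_density_esn_Omega:
  assumes "pos_def \<Sigma>"
  shows "mvn_density (vec_snoc \<mu> 0) (esn_Omega \<Sigma> l) (vec_snoc y t) =
    mvn_const (esn_Omega \<Sigma> l) *
    (exp (- ((y - \<mu>) \<bullet> (matrix_inv \<Sigma> *v (y - \<mu>))) / 2) *
    exp (- (sqrt (1 + l \<bullet> l) * t + l \<bullet> (matrix_inv (mat_sqrt \<Sigma>) *v (y - \<mu>)))\<^sup>2 / 2))"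
  unfolding mvn_density_def mvn_const_def vec_snoc_diff esn_Omega_quadratic_form[OF assms] diff_zero
  by (simp add: add_divide_distrib flip: exp_add)

section \<open>Integrating out the last coordinate\<close>

lemma std_normal_cdf_nonneg: "0 \<le> std_normal_cdf x"
  by (simp add: std_normal_cdf_def cdf_def)

lemma std_normal_cdf_measurable [measurable]: "std_normal_cdf \<in> borel_measurable borel"
proof -
  interpret real_distribution std_normal_distribution by (rule real_dist_normal_dist)
  show ?thesis
    unfolding std_normal_cdf_def
    by (rule borel_measurable_mono) (simp add: mono_def cdf_nondecreasing)
qed

text \<open>
  The substitution \<open>s = c t + d\<close> turns the integral into one of the standard normal density over
  \<open>s \<le> c u + d\<close>.
\<close>

lemma nn_integral_gaussian_halfline:
  assumes "0 < c"
  shows "(\<integral>\<^sup>+ t. indicator {..u} t * ennreal (exp (- (c * t + d)\<^sup>2 / 2)) \<partial>lborel)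
    = ennreal (sqrt (2 * pi) / c * std_normal_cdf (c * u + d))"
proof -
  interpret real_distribution std_normal_distribution by (rule real_dist_normal_dist)
  let ?I = "\<integral>\<^sup>+ t. indicator {..u} t * ennreal (exp (- (c * t + d)\<^sup>2 / 2)) \<partial>lborel"
  have "ennreal (std_normal_cdf (c * u + d)) = emeasure std_normal_distribution {..c * u + d}"
    by (simp add: std_normal_cdf_def cdf_def emeasure_eq_measure)
  also have "\<dots> = (\<integral>\<^sup>+ s. ennreal (std_normal_density s) * indicator {..c * u + d} s \<partial>lborel)"
    by (simp add: emeasure_density)
  also have "\<dots> = ennreal \<bar>c\<bar> *
      (\<integral>\<^sup>+ t. ennreal (std_normal_density (d + c * t)) * indicator {..c * u + d} (d + c * t) \<partial>lborel)"
    using assms by (intro nn_integral_real_affine) auto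
  also have "(\<lambda>t. ennreal (std_normal_density (d + c * t)) * indicator {..c * u + d} (d + c * t))
    = (\<lambda>t. ennreal (1 / sqrt (2 * pi)) * (indicator {..u} t * ennreal (exp (- (c * t + d)\<^sup>2 / 2))))"
    using assms
    by (auto simp: fun_eq_iff std_normal_density_def add.commute ennreal_mult[symmetric]
        split: split_indicator)
  also have "(\<integral>\<^sup>+ t. \<dots> t \<partial>lborel) = ennreal (1 / sqrt (2 * pi)) * ?I"
    by (intro nn_integral_cmult) auto
  finally have "ennreal (sqrt (2 * pi) / c) * ennreal (std_normal_cdf (c * u + d)) =
      (ennreal (sqrt (2 * pi) / c) * ennreal c * ennreal (1 / sqrt (2 * pi))) * ?I"
    using assms by (simp add: mult.assoc)
  also have "ennreal (sqrt (2 * pi) / c) * ennreal c * ennreal (1 / sqrt (2 * pi)) = 1"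
    using assms by (simp flip: ennreal_mult)
  finally have "?I = ennreal (sqrt (2 * pi) / c) * ennreal (std_normal_cdf (c * u + d))" by simp
  also have "\<dots> = ennreal (sqrt (2 * pi) / c * std_normal_cdf (c * u + d))"
    using assms by (intro ennreal_mult[symmetric]) (simp_all add: std_normal_cdf_nonneg)
  finally show ?thesis .
qed

lemma prod_Basis_vec: "(\<Prod>b\<in>Basis. x \<bullet> b) = (\<Prod>i\<in>UNIV. x $ i)" for x :: "real ^ 'n"
proof -
  have "(\<Prod>b\<in>range (\<lambda>i. axis i 1). x \<bullet> b) = (\<Prod>i\<in>UNIV. x $ i)"
    by (subst prod.reindex) (simp_all add: inj_on_def axis_eq_axis inner_axis)
  moreover have "(Basis :: (real ^ 'n) set) = range (\<lambda>i. axis i 1)"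
    by (auto simp: Basis_vec_def)
  ultimately show ?thesis by simp
qed

lemma mem_box_vec: "x \<in> box l u \<longleftrightarrow> (\<forall>i. l $ i < x $ i \<and> x $ i < u $ i)"
  for x :: "real ^ 'n"
  by (auto simp: mem_box Basis_vec_def inner_axis)

lemma continuous_on_vec_snoc [continuous_intros]:
  assumes "continuous_on A f" "continuous_on A g"
  shows "continuous_on A (\<lambda>x. vec_snoc (f x) (g x))"
  unfolding vec_snoc_def
proof (rule continuous_on_vec_lambda)
  show "continuous_on A (\<lambda>x. case i of Some j \<Rightarrow> f x $ j | None \<Rightarrow> g x)" for i
    by (cases i) (auto intro!: continuous_intros assms)
qed

lemma vec_snoc_measurable [measurable]:
  "(\<lambda>(y :: real ^ 'n, t). vec_snoc y t) \<in> borel_measurable (lborel \<Otimes>\<^sub>M lborel)"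
  unfolding lborel_prod
  by (simp add: split_beta')
    (intro borel_measurable_continuous_onI continuous_intros)

lemma vec_init_measurable [measurable]: "vec_init \<in> borel_measurable (borel :: (real ^ ('n::finite option)) measure)"
  unfolding vec_init_def
  by (intro borel_measurable_continuous_onI continuous_intros)

text \<open>
  Lebesgue measure is determined by its values on boxes, and appending a coordinate pulls a box back
  to the product of a box and an interval.
\<close>

lemma lborel_vec_snoc:
  "(lborel :: (real ^ ('n::finite option)) measure)
    = distr (lborel \<Otimes>\<^sub>M lborel) borel (\<lambda>(y, t). vec_snoc (y :: real ^ 'n) t)" (is "_ = ?D")
proof (rule lborel_eqI)
  fix l u :: "real ^ ('n::finite option)"
  assume le: "\<And>b. b \<in> Basis \<Longrightarrow> l \<bullet> b \<le> u \<bullet> b"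
  have le': "l $ i \<le> u $ i" for i
    using le[of "axis i 1"] by (simp add: inner_axis axis_in_Basis_iff)
  have "(\<lambda>(y, t). vec_snoc y t) -` box l u \<inter> space (lborel \<Otimes>\<^sub>M lborel)
      = box (vec_init l) (vec_init u) \<times> box (l $ None) (u $ None)"
    by (auto simp: mem_box_vec all_option space_pair_measure)
  then have "emeasure ?D (box l u)
      = emeasure (lborel \<Otimes>\<^sub>M lborel) (box (vec_init l) (vec_init u) \<times> box (l $ None) (u $ None))"
    by (simp add: emeasure_distr)
  also have "\<dots> = emeasure lborel (box (vec_init l) (vec_init u)) * emeasure lborel (box (l $ None) (u $ None))"
    by (rule lborel.emeasure_pair_measure_Times) auto
  also have "\<dots> = ennreal (\<Prod>i\<in>UNIV. (vec_init u - vec_init l) $ i) * ennreal (u $ None - l $ None)"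
  proof -
    have "vec_init l \<bullet> b \<le> vec_init u \<bullet> b" if "b \<in> Basis" for b
      using that le' by (auto simp: Basis_vec_def inner_axis)
    then show ?thesis
      using le' by (simp only: emeasure_lborel_box prod_Basis_vec) simp
  qed
  also have "\<dots> = ennreal (\<Prod>i\<in>UNIV. (u - l) $ i)"
    using le' by (simp add: prod_option ennreal_mult[symmetric] prod_nonneg mult.commute)
  finally show "emeasure ?D (box l u) = (\<Prod>b\<in>Basis. (u - l) \<bullet> b)"
    by (simp add: prod_Basis_vec)
qed simp

lemma nn_integral_lborel_vec_snoc:
  assumes [measurable]: "f \<in> borel_measurable (borel :: (real ^ ('n::finite option)) measure)"
  shows "(\<integral>\<^sup>+ x. f x \<partial>lborel) = (\<integral>\<^sup>+ y. (\<integral>\<^sup>+ t. f (vec_snoc y t) \<partial>lborel) \<partial>lborel)"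
proof -
  have "(\<integral>\<^sup>+ x. f x \<partial>lborel) = (\<integral>\<^sup>+ (y, t). f (vec_snoc y t) \<partial>(lborel \<Otimes>\<^sub>M lborel))"
    by (subst lborel_vec_snoc) (simp add: nn_integral_distr split_beta')
  also have "\<dots> = (\<integral>\<^sup>+ y. (\<integral>\<^sup>+ t. f (vec_snoc y t) \<partial>lborel) \<partial>lborel)"
    by (subst lborel.nn_integral_fst[symmetric]) (auto simp: split_beta')
  finally show ?thesis .
qed

lemma mvn_density_measurable [measurable]: "mvn_density \<mu> \<Sigma> \<in> borel_measurable borel"
  unfolding mvn_density_def divide_inverse
  by (intro borel_measurable_continuous_onI continuous_intros
      continuous_on_compose2[OF matrix_vector_mult_linear_continuous_on]) auto

text \<open>
  The extended skew-normal density up to a constant factor. Only this unnormalised form matters,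
  because the constant cancels in a conditional expectation.
\<close>

definition esn_kernel ::
  "real ^ 'n \<Rightarrow> real ^ 'n ^ 'n \<Rightarrow> real ^ 'n \<Rightarrow> real \<Rightarrow> real ^ 'n \<Rightarrow> real" where
  "esn_kernel \<mu> \<Sigma> l \<tau> y =
     exp (- ((y - \<mu>) \<bullet> (matrix_inv \<Sigma> *v (y - \<mu>))) / 2) *
     std_normal_cdf (\<tau> + l \<bullet> (matrix_inv (mat_sqrt \<Sigma>) *v (y - \<mu>)))"

lemma esn_kernel_nonneg: "0 \<le> esn_kernel \<mu> \<Sigma> l \<tau> y"
  by (simp add: esn_kernel_def std_normal_cdf_nonneg)

lemma esn_kernel_measurable [measurable]: "esn_kernel \<mu> \<Sigma> l \<tau> \<in> borel_measurable borel"
  for \<mu> :: "real ^ 'n"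
proof -
  have [measurable]: "(\<lambda>y. A *v (y - \<mu>)) \<in> borel_measurable borel" for A :: "real ^ 'n ^ 'n"
    by (intro borel_measurable_continuous_onI continuous_intros
        continuous_on_compose2[OF matrix_vector_mult_linear_continuous_on]) auto
  show ?thesis unfolding esn_kernel_def by measurable
qed

lemma esn_density_kernel:
  "esn_density \<mu> \<Sigma> l \<tau> y =
    inverse (std_normal_cdf (esn_tau l \<tau>)) * mvn_const \<Sigma> * esn_kernel \<mu> \<Sigma> l \<tau> y"
  by (simp add: esn_density_def mvn_density_def esn_kernel_def mvn_const_def)

text \<open>
  The heart of the proof: integrating the \<open>(p + 1)\<close>-variate normal density over a last coordinate
  \<open>t \<le> \<tau> / \<surd>(1 + \<lambda> \<bullet> \<lambda>)\<close> leaves a multiple of the skew-normal density. After completing the square the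
  integrand in \<open>t\<close> is a Gaussian in \<open>\<surd>(1 + \<lambda> \<bullet> \<lambda>) t + d\<close>, and the upper limit is chosen so that this
  linear expression ends at \<open>\<tau> + d\<close>, the argument of the cdf in the skew-normal density.
\<close>

lemma nn_integral_truncated_last_coordinate:
  fixes f :: "real ^ 'n \<Rightarrow> ennreal"
  assumes \<Sigma>: "pos_def \<Sigma>" and pos: "0 < mvn_const (esn_Omega \<Sigma> l)"
    and [measurable]: "f \<in> borel_measurable borel"
  shows "(\<integral>\<^sup>+ x. ennreal (mvn_density (vec_snoc \<mu> 0) (esn_Omega \<Sigma> l) x) *
      (f (vec_init x) * indicator {..esn_tau l \<tau>} (x $ None)) \<partial>lborel)
    = (\<integral>\<^sup>+ y. ennreal (mvn_const (esn_Omega \<Sigma> l) * (sqrt (2 * pi) / sqrt (1 + l \<bullet> l)) *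
        esn_kernel \<mu> \<Sigma> l \<tau> y) * f y \<partial>lborel)"
proof -
  define C where "C = mvn_const (esn_Omega \<Sigma> l)"
  define c where "c = sqrt (1 + l \<bullet> l)"
  have "0 < c" by (simp add: c_def add_pos_nonneg)
  have "0 < C" using pos by (simp add: C_def)
  have tau: "c * esn_tau l \<tau> = \<tau>" using \<open>0 < c\<close> by (simp add: esn_tau_def c_def)
  have inner: "(\<integral>\<^sup>+ t. ennreal (mvn_density (vec_snoc \<mu> 0) (esn_Omega \<Sigma> l) (vec_snoc y t)) *
      (f y * indicator {..esn_tau l \<tau>} t) \<partial>lborel)
    = ennreal (C * (sqrt (2 * pi) / c) * esn_kernel \<mu> \<Sigma> l \<tau> y) * f y" (is "?L = _") for y
  proof -
    define e where "e = exp (- ((y - \<mu>) \<bullet> (matrix_inv \<Sigma> *v (y - \<mu>))) / 2)"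
    define d where "d = l \<bullet> (matrix_inv (mat_sqrt \<Sigma>) *v (y - \<mu>))"
    have "?L = (\<integral>\<^sup>+ t. (ennreal (C * e) * f y) *
        (indicator {..esn_tau l \<tau>} t * ennreal (exp (- (c * t + d)\<^sup>2 / 2))) \<partial>lborel)"
      using \<open>0 < C\<close>
      by (simp add: mvn_density_esn_Omega[OF \<Sigma>] ennreal_mult' e_def mult_ac flip: C_def c_def d_def)
    also have "\<dots> = ennreal (C * e) * f y *
        ennreal (sqrt (2 * pi) / c * std_normal_cdf (c * esn_tau l \<tau> + d))"
      by (simp add: nn_integral_cmult nn_integral_gaussian_halfline[OF \<open>0 < c\<close>, simplified])
    also have "\<dots> = ennreal ((C * e) * (sqrt (2 * pi) / c * std_normal_cdf (\<tau> + d))) * f y"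
      using \<open>0 < C\<close> \<open>0 < c\<close>
      by (subst ennreal_mult) (simp_all add: tau e_def std_normal_cdf_nonneg mult_ac)
    finally show ?thesis by (simp add: esn_kernel_def e_def d_def mult_ac)
  qed
  show ?thesis
    by (subst nn_integral_lborel_vec_snoc) (simp_all add: inner flip: C_def c_def)
qed

section \<open>Conditional expectations from proportional densities\<close>

text \<open>
  The reason why no determinant and no normalising constant has to be evaluated: if the factor \<open>C\<close>
  were not positive, the density would be truncated to zero by \<open>ennreal\<close> and could not have total
  mass one.
\<close>

lemma density_constant_pos:
  fixes h :: "'b::euclidean_space \<Rightarrow> real"
  assumes "prob_space M" and "distributed M lborel Z (\<lambda>z. ennreal (C * h z))"
    and "\<And>z. 0 \<le> h z"
  shows "0 < C"
proof (rule ccontr)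
  assume "\<not> 0 < C"
  then have zero: "ennreal (C * h z) = 0" for z
    using assms(3)[of z] by (simp add: ennreal_eq_0_iff mult_nonpos_nonneg)
  have "emeasure M (space M) = (\<integral>\<^sup>+ z. ennreal (C * h z) * indicator UNIV z \<partial>lborel)"
    using distributed_emeasure[OF assms(2), of UNIV] by (simp add: vimage_def)
  then show False
    using prob_space.emeasure_space_1[OF assms(1)] by (simp add: zero)
qed

text \<open>
  The event \<open>B\<close> stands for a condition on further coordinates that \<open>Z\<close> does not see. The hypothesis
  \<open>law\<close> describes the distribution of \<open>Z\<close> restricted to \<open>B\<close>; the factor \<open>C\<close> occurs in both the
  numerator and the probability of the event, so the conditional expectation depends on \<open>h\<close> alone.
  The change of variables for Bochner integrals holds also when \<open>f\<close> is not integrable, both sides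
  being zero then, so no moment has to be shown to exist.
\<close>

lemma event_expectation_proportional_density:
  fixes Z :: "'a \<Rightarrow> 'b::euclidean_space" and f h :: "'b \<Rightarrow> real"
  assumes "prob_space M" and [measurable]: "Z \<in> borel_measurable M" "B \<in> sets M"
    and "0 < C" and h: "\<And>z. 0 \<le> h z"
    and [measurable]: "h \<in> borel_measurable borel" "f \<in> borel_measurable borel" "A \<in> sets borel"
    and law: "\<And>A. A \<in> sets borel \<Longrightarrow>
      emeasure M {\<omega> \<in> B. Z \<omega> \<in> A} = (\<integral>\<^sup>+ z. ennreal (C * h z) * indicator A z \<partial>lborel)"
  shows "event_expectation M (\<lambda>\<omega>. f (Z \<omega>)) {\<omega> \<in> B. Z \<omega> \<in> A} =
    (LINT z|lborel. h z * (indicator A z * f z)) / (LINT z|lborel. h z * indicator A z)"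
proof -
  interpret prob_space M by fact
  have B: "B \<subseteq> space M" using assms(3) by (rule sets.sets_into_space)
  let ?\<nu> = "density lborel (\<lambda>z. ennreal (C * h z))"
  have "distr (density M (\<lambda>\<omega>. ennreal (indicator B \<omega>))) borel Z = ?\<nu>"
  proof (rule measure_eqI)
    fix D assume "D \<in> sets (distr (density M (\<lambda>\<omega>. ennreal (indicator B \<omega>))) borel Z)"
    then have [measurable]: "D \<in> sets borel" by simp
    have "emeasure (distr (density M (\<lambda>\<omega>. ennreal (indicator B \<omega>))) borel Z) D
        = (\<integral>\<^sup>+ \<omega>. indicator B \<omega> * indicator (Z -` D \<inter> space M) \<omega> \<partial>M)"
      by (simp add: emeasure_distr emeasure_density ennreal_indicator)
    also have "\<dots> = (\<integral>\<^sup>+ \<omega>. indicator {\<omega> \<in> B. Z \<omega> \<in> D} \<omega> \<partial>M)"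
      using B by (intro nn_integral_cong) (auto split: split_indicator)
    also have "\<dots> = emeasure M {\<omega> \<in> B. Z \<omega> \<in> D}"
    proof -
      have "{\<omega> \<in> B. Z \<omega> \<in> D} = B \<inter> (Z -` D \<inter> space M)" using B by auto
      then have "{\<omega> \<in> B. Z \<omega> \<in> D} \<in> sets M" by simp
      then show ?thesis by simp
    qed
    also have "\<dots> = emeasure ?\<nu> D"
      by (simp add: law emeasure_density)
    finally show "emeasure (distr (density M (\<lambda>\<omega>. ennreal (indicator B \<omega>))) borel Z) D = emeasure ?\<nu> D" .
  qed simp
  note distr = this
  have int: "(LINT \<omega>|M. indicator B \<omega> * (indicator A (Z \<omega>) * g (Z \<omega>)))
      = C * (LINT z|lborel. h z * (indicator A z * g z))"
    if [measurable]: "g \<in> borel_measurable borel" for g :: "'b \<Rightarrow> real"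
  proof -
    have "(LINT \<omega>|M. indicator B \<omega> * (indicator A (Z \<omega>) * g (Z \<omega>)))
        = (LINT z|distr (density M (\<lambda>\<omega>. ennreal (indicator B \<omega>))) borel Z. indicator A z * g z)"
      by (simp add: integral_distr integral_density)
    also have "\<dots> = (LINT z|lborel. C * (h z * (indicator A z * g z)))"
      using \<open>0 < C\<close> h by (simp add: distr integral_density mult.assoc)
    finally show ?thesis by simp
  qed
  have ind: "indicator {\<omega> \<in> B. Z \<omega> \<in> A} \<omega> = (indicator B \<omega> * indicator A (Z \<omega>) :: real)" for \<omega>
    by (simp split: split_indicator)
  have num: "(LINT \<omega>:{\<omega> \<in> B. Z \<omega> \<in> A}|M. f (Z \<omega>)) = C * (LINT z|lborel. h z * (indicator A z * f z))"
    using int[of f] by (simp add: set_lebesgue_integral_def ind mult.assoc)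
  have "{\<omega> \<in> B. Z \<omega> \<in> A} = B \<inter> (Z -` A \<inter> space M)" using B by auto
  then have "{\<omega> \<in> B. Z \<omega> \<in> A} \<in> sets M" by simp
  then have "measure M {\<omega> \<in> B. Z \<omega> \<in> A} = (LINT \<omega>|M. indicator {\<omega> \<in> B. Z \<omega> \<in> A} \<omega>)"
    by (simp add: sets.Int_space_eq2)
  then have den: "measure M {\<omega> \<in> B. Z \<omega> \<in> A} = C * (LINT z|lborel. h z * indicator A z)"
    using int[of "\<lambda>_. 1"] by (simp add: ind)
  show ?thesis
    using \<open>0 < C\<close> by (simp add: event_expectation_def num den)
qed

section \<open>Truncated moments\<close>

definition ebox :: "ereal ^ 'n \<Rightarrow> ereal ^ 'n \<Rightarrow> (real ^ 'n) set" where
  "ebox a b = {y. \<forall>i. a $ i \<le> ereal (y $ i) \<and> ereal (y $ i) \<le> b $ i}"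

lemma ebox_measurable [measurable]: "ebox a b \<in> sets borel"
  for a b :: "ereal ^ 'n"
proof -
  have [measurable]: "(\<lambda>y :: real ^ 'n. y $ i) \<in> borel_measurable borel" for i
    by (intro borel_measurable_continuous_onI continuous_intros)
  show ?thesis unfolding ebox_def by measurable
qed

lemma vec_power_measurable [measurable]: "(\<lambda>y. vec_power y k) \<in> borel_measurable borel"
  unfolding vec_power_def
  by (intro borel_measurable_continuous_onI continuous_intros)

lemma vec_power_snoc_zero: "vec_power x (vec_snoc k 0) = vec_power (vec_init x) k"
  by (simp add: vec_power_def prod_option)

lemma trunc_event_snoc:
  "trunc_event N X (vec_snoc a (-\<infinity>)) (vec_snoc b (ereal u)) =
    {\<omega> \<in> {\<omega> \<in> space N. X \<omega> $ None \<le> u}. vec_init (X \<omega>) \<in> ebox a b}"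
  by (auto simp: trunc_event_def ebox_def all_option)

theorem corollary1:
  fixes M :: "'a measure" and N :: "'b measure"
    and Y :: "'a \<Rightarrow> real ^ 'n" and X :: "'b \<Rightarrow> real ^ ('n option)"
    and \<mu> l :: "real ^ 'n" and \<Sigma> :: "real ^ 'n ^ 'n" and \<tau> :: real
    and a b :: "ereal ^ 'n" and k :: "nat ^ 'n"
  assumes "prob_space M" and "prob_space N"
    and "pos_def \<Sigma>"
    and "has_esn M Y \<mu> \<Sigma> l \<tau>"
    and "has_mvn N X (vec_snoc \<mu> 0) (esn_Omega \<Sigma> l)"
    and "measure M (trunc_event M Y a b) > 0"
  shows "event_expectation M (\<lambda>\<omega>. vec_power (Y \<omega>) k) (trunc_event M Y a b) =
         event_expectation N (\<lambda>\<omega>. vec_power (X \<omega>) (vec_snoc k 0))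
           (trunc_event N X (vec_snoc a (-\<infinity>)) (vec_snoc b (ereal (esn_tau l \<tau>))))"
proof -
  let ?h = "esn_kernel \<mu> \<Sigma> l \<tau>"
  \<comment> \<open>Both conditional expectations are evaluated as the same quotient.\<close>
  let ?E = "(LINT y|lborel. ?h y * (indicator (ebox a b) y * vec_power y k))
    / (LINT y|lborel. ?h y * indicator (ebox a b) y)"
  have "event_expectation M (\<lambda>\<omega>. vec_power (Y \<omega>) k) {\<omega> \<in> space M. Y \<omega> \<in> ebox a b} = ?E"
  proof (rule event_expectation_proportional_density)
    let ?C = "inverse (std_normal_cdf (esn_tau l \<tau>)) * mvn_const \<Sigma>"
    have Y: "distributed M lborel Y (\<lambda>y. ennreal (?C * ?h y))"
      using assms(4) by (simp add: has_esn_def esn_density_kernel)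
    show "Y \<in> borel_measurable M"
      using distributed_measurable[OF Y] by simp
    show "0 < ?C"
      by (rule density_constant_pos[OF assms(1) Y esn_kernel_nonneg])
    show "emeasure M {\<omega> \<in> space M. Y \<omega> \<in> A} = (\<integral>\<^sup>+ y. ennreal (?C * ?h y) * indicator A y \<partial>lborel)"
      if "A \<in> sets borel" for A
      using distributed_emeasure[OF Y, of A] that by (simp add: vimage_def Int_def conj_commute)
  qed (simp_all add: assms(1) esn_kernel_nonneg)
  moreover have "trunc_event M Y a b = {\<omega> \<in> space M. Y \<omega> \<in> ebox a b}"
    by (simp add: trunc_event_def ebox_def)
  moreover have "event_expectation N (\<lambda>\<omega>. vec_power (vec_init (X \<omega>)) k)
      {\<omega> \<in> {\<omega> \<in> space N. X \<omega> $ None \<le> esn_tau l \<tau>}. vec_init (X \<omega>) \<in> ebox a b} = ?E"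
  proof (rule event_expectation_proportional_density)
    let ?\<Omega> = "esn_Omega \<Sigma> l"
    let ?C = "mvn_const ?\<Omega> * (sqrt (2 * pi) / sqrt (1 + l \<bullet> l))"
    let ?g = "mvn_density (vec_snoc \<mu> 0) ?\<Omega>"
    have X: "distributed N lborel X (\<lambda>x. ennreal (?g x))"
      using assms(5) by (simp add: has_mvn_def)
    then have [measurable]: "X \<in> borel_measurable N"
      using distributed_measurable by fastforce
    have [measurable]: "(\<lambda>x :: real ^ 'n option. x $ None) \<in> borel_measurable borel"
      by (intro borel_measurable_continuous_onI continuous_intros)
    show "(\<lambda>\<omega>. vec_init (X \<omega>)) \<in> borel_measurable N" by measurable
    show "{\<omega> \<in> space N. X \<omega> $ None \<le> esn_tau l \<tau>} \<in> sets N" by measurable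
    have C: "0 < mvn_const ?\<Omega>"
    proof (rule density_constant_pos[OF assms(2)])
      show "distributed N lborel X (\<lambda>x. ennreal (mvn_const ?\<Omega> *
          exp (- ((x - vec_snoc \<mu> 0) \<bullet> (matrix_inv ?\<Omega> *v (x - vec_snoc \<mu> 0))) / 2)))"
        using X by (simp add: mvn_density_def mvn_const_def)
    qed simp
    then show "0 < ?C" by (simp add: add_pos_nonneg)
    show "emeasure N {\<omega> \<in> {\<omega> \<in> space N. X \<omega> $ None \<le> esn_tau l \<tau>}. vec_init (X \<omega>) \<in> A}
        = (\<integral>\<^sup>+ y. ennreal (?C * ?h y) * indicator A y \<partial>lborel)"
      if [measurable]: "A \<in> sets borel" for A
    proof -
      let ?D = "{x. x $ None \<le> esn_tau l \<tau> \<and> vec_init x \<in> A}"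
      have D: "?D \<in> sets borel" by measurable
      have "{\<omega> \<in> {\<omega> \<in> space N. X \<omega> $ None \<le> esn_tau l \<tau>}. vec_init (X \<omega>) \<in> A} = X -` ?D \<inter> space N"
        by auto
      also have "emeasure N (X -` ?D \<inter> space N) = (\<integral>\<^sup>+ x. ennreal (?g x) * indicator ?D x \<partial>lborel)"
        using distributed_emeasure[OF X, of ?D] D by simp
      also have "\<dots> = (\<integral>\<^sup>+ x. ennreal (?g x) *
          (indicator A (vec_init x) * indicator {..esn_tau l \<tau>} (x $ None)) \<partial>lborel)"
        by (intro nn_integral_cong) (auto split: split_indicator)
      also have "\<dots> = (\<integral>\<^sup>+ y. ennreal (?C * ?h y) * indicator A y \<partial>lborel)"
        by (rule nn_integral_truncated_last_coordinate[OF assms(3) C]) simp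
      finally show ?thesis .
    qed
  qed (simp_all add: assms(2) esn_kernel_nonneg)
  ultimately show ?thesis
    by (simp only: trunc_event_snoc vec_power_snoc_zero)
qed

end
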